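(* Let $\mathcal{B}$ be an additive category and let $\mathcal{B}_0$ be a full subcategory of $\mathcal{B}$. Then there is at most one exact structure on $\mathcal{B}$ which makes $\mathcal{B}$ into a Frobenius category with $\mathcal{B}_0$ being the full subcategory of projective-injective objects.
   Context: Exact structure is meant in the sense of Quillen. A Frobenius category is an exact category with enough projectives and enough injectives in which the projective objects coincide with the injective objects. *)

theory Defs
  imports "HOL-Algebra.Group"
begin

section \<open>Additive categories\<close>

text \<open>
  A category has a set of objects and a set of arrows. Every arrow has one domain and one
  codomain, so distinct hom-sets are disjoint and an arrow determines its end points.
  \<open>g \<cdot> f\<close> means \<open>g\<close> after \<open>f\<close>; it is unspecified when the two are not composable.
\<close>

record ('o, 'm) cat =
  Ob :: "'o set"
  Arr :: "'m set"
  Dom :: "'m \<Rightarrow> 'o"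
  Cod :: "'m \<Rightarrow> 'o"
  Ident :: "'o \<Rightarrow> 'm"
  Comp :: "'m \<Rightarrow> 'm \<Rightarrow> 'm"  (infixl "\<cdot>\<index>" 70)

record ('o, 'm) addcat = "('o, 'm) cat" +
  Add :: "'m \<Rightarrow> 'm \<Rightarrow> 'm"  (infixl "\<boxplus>\<index>" 65)
  Zero :: "'o \<Rightarrow> 'o \<Rightarrow> 'm"

definition Hom :: "('o, 'm, 'z) cat_scheme \<Rightarrow> 'o \<Rightarrow> 'o \<Rightarrow> 'm set" where
  "Hom C x y = {f \<in> Arr C. Dom C f = x \<and> Cod C f = y}"

locale category =
  fixes C :: "('o, 'm, 'z) cat_scheme" (structure)
  assumes Dom_closed: "f \<in> Arr C \<Longrightarrow> Dom C f \<in> Ob C"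
    and Cod_closed: "f \<in> Arr C \<Longrightarrow> Cod C f \<in> Ob C"
    and Ident_closed: "x \<in> Ob C \<Longrightarrow> Ident C x \<in> Hom C x x"
    and Comp_closed: "\<lbrakk>f \<in> Hom C x y; g \<in> Hom C y z\<rbrakk> \<Longrightarrow> g \<cdot> f \<in> Hom C x z"
    and Comp_assoc: "\<lbrakk>f \<in> Hom C w x; g \<in> Hom C x y; h \<in> Hom C y z\<rbrakk>
          \<Longrightarrow> (h \<cdot> g) \<cdot> f = h \<cdot> (g \<cdot> f)"
    and Comp_Ident_left: "f \<in> Hom C x y \<Longrightarrow> Ident C y \<cdot> f = f"
    and Comp_Ident_right: "f \<in> Hom C x y \<Longrightarrow> f \<cdot> Ident C x = f"

definition hom_group :: "('o, 'm, 'z) addcat_scheme \<Rightarrow> 'o \<Rightarrow> 'o \<Rightarrow> 'm monoid" where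
  "hom_group C x y = \<lparr>carrier = Hom C x y, mult = Add C, one = Zero C x y\<rparr>"

locale preadditive_category = category C
  for C :: "('o, 'm, 'z) addcat_scheme" (structure) +
  assumes hom_comm_group: "\<lbrakk>x \<in> Ob C; y \<in> Ob C\<rbrakk> \<Longrightarrow> comm_group (hom_group C x y)"
    and Comp_Add_left: "\<lbrakk>f \<in> Hom C x y; g \<in> Hom C y z; h \<in> Hom C y z\<rbrakk>
          \<Longrightarrow> (g \<boxplus> h) \<cdot> f = (g \<cdot> f) \<boxplus> (h \<cdot> f)"
    and Comp_Add_right: "\<lbrakk>f \<in> Hom C x y; g \<in> Hom C x y; h \<in> Hom C y z\<rbrakk>
          \<Longrightarrow> h \<cdot> (f \<boxplus> g) = (h \<cdot> f) \<boxplus> (h \<cdot> g)"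

definition zero_object :: "('o, 'm, 'z) cat_scheme \<Rightarrow> 'o \<Rightarrow> bool" where
  "zero_object C z \<longleftrightarrow> z \<in> Ob C \<and>
     (\<forall>x\<in>Ob C. (\<exists>!f. f \<in> Hom C x z) \<and> (\<exists>!f. f \<in> Hom C z x))"

definition biproduct ::
  "('o, 'm, 'z) addcat_scheme \<Rightarrow> 'o \<Rightarrow> 'o \<Rightarrow> 'o \<Rightarrow> 'm \<Rightarrow> 'm \<Rightarrow> 'm \<Rightarrow> 'm \<Rightarrow> bool" where
  "biproduct C a b s i1 i2 p1 p2 \<longleftrightarrow>
     i1 \<in> Hom C a s \<and> i2 \<in> Hom C b s \<and> p1 \<in> Hom C s a \<and> p2 \<in> Hom C s b \<and>
     p1 \<cdot>\<^bsub>C\<^esub> i1 = Ident C a \<and> p2 \<cdot>\<^bsub>C\<^esub> i2 = Ident C b \<and>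
     p1 \<cdot>\<^bsub>C\<^esub> i2 = Zero C b a \<and> p2 \<cdot>\<^bsub>C\<^esub> i1 = Zero C a b \<and>
     (i1 \<cdot>\<^bsub>C\<^esub> p1) \<boxplus>\<^bsub>C\<^esub> (i2 \<cdot>\<^bsub>C\<^esub> p2) = Ident C s"

locale additive_category = preadditive_category C
  for C :: "('o, 'm, 'z) addcat_scheme" (structure) +
  assumes ex_zero_object: "\<exists>z. zero_object C z"
    and ex_biproduct: "\<lbrakk>a \<in> Ob C; b \<in> Ob C\<rbrakk> \<Longrightarrow> \<exists>s i1 i2 p1 p2. biproduct C a b s i1 i2 p1 p2"

definition full_subcategory_on ::
  "('o, 'm, 'z) cat_scheme \<Rightarrow> 'o set \<Rightarrow> ('o, 'm, 'z) cat_scheme" where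
  "full_subcategory_on C S = C\<lparr>Ob := S, Arr := {f \<in> Arr C. Dom C f \<in> S \<and> Cod C f \<in> S}\<rparr>"

text \<open>No closure under isomorphism, direct sums or summands is imposed.\<close>

definition full_subcategory ::
  "('o, 'm, 'z) cat_scheme \<Rightarrow> ('o, 'm, 'z) cat_scheme \<Rightarrow> bool" where
  "full_subcategory D C \<longleftrightarrow> (\<exists>S \<subseteq> Ob C. D = full_subcategory_on C S)"


section \<open>Kernels, cokernels, pullbacks and pushouts\<close>

definition isomorphism :: "('o, 'm, 'z) cat_scheme \<Rightarrow> 'm \<Rightarrow> bool" where
  "isomorphism C f \<longleftrightarrow> f \<in> Arr C \<and>
     (\<exists>g \<in> Hom C (Cod C f) (Dom C f).
        g \<cdot>\<^bsub>C\<^esub> f = Ident C (Dom C f) \<and> f \<cdot>\<^bsub>C\<^esub> g = Ident C (Cod C f))"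

definition is_kernel :: "('o, 'm, 'z) addcat_scheme \<Rightarrow> 'm \<Rightarrow> 'm \<Rightarrow> bool" where
  "is_kernel C k f \<longleftrightarrow>
     k \<in> Arr C \<and> f \<in> Arr C \<and> Cod C k = Dom C f \<and> f \<cdot>\<^bsub>C\<^esub> k = Zero C (Dom C k) (Cod C f) \<and>
     (\<forall>t \<in> Arr C. Cod C t = Dom C f \<and> f \<cdot>\<^bsub>C\<^esub> t = Zero C (Dom C t) (Cod C f) \<longrightarrow>
        (\<exists>!u. u \<in> Hom C (Dom C t) (Dom C k) \<and> k \<cdot>\<^bsub>C\<^esub> u = t))"

definition is_cokernel :: "('o, 'm, 'z) addcat_scheme \<Rightarrow> 'm \<Rightarrow> 'm \<Rightarrow> bool" where
  "is_cokernel C c f \<longleftrightarrow>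
     c \<in> Arr C \<and> f \<in> Arr C \<and> Dom C c = Cod C f \<and> c \<cdot>\<^bsub>C\<^esub> f = Zero C (Dom C f) (Cod C c) \<and>
     (\<forall>t \<in> Arr C. Dom C t = Cod C f \<and> t \<cdot>\<^bsub>C\<^esub> f = Zero C (Dom C f) (Cod C t) \<longrightarrow>
        (\<exists>!u. u \<in> Hom C (Cod C c) (Cod C t) \<and> u \<cdot>\<^bsub>C\<^esub> c = t))"

text \<open>In \<open>is_pullback C p f p' f'\<close> the arrow \<open>p'\<close> is the base change of \<open>p\<close> along \<open>f\<close>;
  in \<open>is_pushout C i f i' f'\<close> the arrow \<open>i'\<close> is the cobase change of \<open>i\<close> along \<open>f\<close>.\<close>

definition is_pullback :: "('o, 'm, 'z) cat_scheme \<Rightarrow> 'm \<Rightarrow> 'm \<Rightarrow> 'm \<Rightarrow> 'm \<Rightarrow> bool" where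
  "is_pullback C p f p' f' \<longleftrightarrow>
     p \<in> Arr C \<and> f \<in> Arr C \<and> p' \<in> Arr C \<and> f' \<in> Arr C \<and>
     Cod C p = Cod C f \<and> Dom C p' = Dom C f' \<and> Cod C p' = Dom C f \<and> Cod C f' = Dom C p \<and>
     p \<cdot>\<^bsub>C\<^esub> f' = f \<cdot>\<^bsub>C\<^esub> p' \<and>
     (\<forall>s \<in> Arr C. \<forall>t \<in> Arr C.
        Dom C s = Dom C t \<and> Cod C s = Dom C p \<and> Cod C t = Dom C f \<and> p \<cdot>\<^bsub>C\<^esub> s = f \<cdot>\<^bsub>C\<^esub> t \<longrightarrow>
        (\<exists>!u. u \<in> Hom C (Dom C s) (Dom C p') \<and> f' \<cdot>\<^bsub>C\<^esub> u = s \<and> p' \<cdot>\<^bsub>C\<^esub> u = t))"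

definition is_pushout :: "('o, 'm, 'z) cat_scheme \<Rightarrow> 'm \<Rightarrow> 'm \<Rightarrow> 'm \<Rightarrow> 'm \<Rightarrow> bool" where
  "is_pushout C i f i' f' \<longleftrightarrow>
     i \<in> Arr C \<and> f \<in> Arr C \<and> i' \<in> Arr C \<and> f' \<in> Arr C \<and>
     Dom C i = Dom C f \<and> Cod C i' = Cod C f' \<and> Dom C i' = Cod C f \<and> Dom C f' = Cod C i \<and>
     f' \<cdot>\<^bsub>C\<^esub> i = i' \<cdot>\<^bsub>C\<^esub> f \<and>
     (\<forall>s \<in> Arr C. \<forall>t \<in> Arr C.
        Cod C s = Cod C t \<and> Dom C s = Cod C i \<and> Dom C t = Cod C f \<and> s \<cdot>\<^bsub>C\<^esub> i = t \<cdot>\<^bsub>C\<^esub> f \<longrightarrow>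
        (\<exists>!u. u \<in> Hom C (Cod C i') (Cod C s) \<and> u \<cdot>\<^bsub>C\<^esub> f' = s \<and> u \<cdot>\<^bsub>C\<^esub> i' = t))"


section \<open>Exact structures in the sense of Quillen\<close>

text \<open>A sequence \<open>X \<rightarrow> Y \<rightarrow> Z\<close> is the pair \<open>(i, p)\<close> of its two arrows, and an exact structure
  is the set of its short exact sequences.\<close>

definition seq_iso :: "('o, 'm, 'z) cat_scheme \<Rightarrow> 'm \<times> 'm \<Rightarrow> 'm \<times> 'm \<Rightarrow> bool" where
  "seq_iso C = (\<lambda>(i, p) (i', p'). \<exists>a b c.
     isomorphism C a \<and> isomorphism C b \<and> isomorphism C c \<and>
     a \<in> Hom C (Dom C i) (Dom C i') \<and> b \<in> Hom C (Cod C i) (Cod C i') \<and>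
     c \<in> Hom C (Cod C p) (Cod C p') \<and>
     b \<cdot>\<^bsub>C\<^esub> i = i' \<cdot>\<^bsub>C\<^esub> a \<and> c \<cdot>\<^bsub>C\<^esub> p = p' \<cdot>\<^bsub>C\<^esub> b)"

definition admissible_mono :: "('m \<times> 'm) set \<Rightarrow> 'm \<Rightarrow> bool" where
  "admissible_mono E i \<longleftrightarrow> (\<exists>p. (i, p) \<in> E)"

definition admissible_epi :: "('m \<times> 'm) set \<Rightarrow> 'm \<Rightarrow> bool" where
  "admissible_epi E p \<longleftrightarrow> (\<exists>i. (i, p) \<in> E)"

text \<open>Quillen's original axioms, including the last pair (\<open>obscure_epi\<close>, \<open>obscure_mono\<close>),
  which is known to follow from the others.\<close>

locale exact_category = additive_category C
  for C :: "('o, 'm, 'z) addcat_scheme" (structure) and E :: "('m \<times> 'm) set" +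
  assumes kernel_cokernel: "(i, p) \<in> E \<Longrightarrow> is_kernel C i p \<and> is_cokernel C p i"
    and iso_closed: "\<lbrakk>(i, p) \<in> E; i' \<in> Arr C; p' \<in> Arr C; Cod C i' = Dom C p';
          seq_iso C (i, p) (i', p')\<rbrakk> \<Longrightarrow> (i', p') \<in> E"
    and split_exact: "\<lbrakk>a \<in> Ob C; b \<in> Ob C; biproduct C a b s i1 i2 p1 p2\<rbrakk> \<Longrightarrow> (i1, p2) \<in> E"
    and epi_comp: "\<lbrakk>admissible_epi E p; admissible_epi E q; Cod C p = Dom C q\<rbrakk>
          \<Longrightarrow> admissible_epi E (q \<cdot> p)"
    and mono_comp: "\<lbrakk>admissible_mono E i; admissible_mono E j; Cod C i = Dom C j\<rbrakk>
          \<Longrightarrow> admissible_mono E (j \<cdot> i)"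
    and epi_base_change: "\<lbrakk>admissible_epi E p; f \<in> Arr C; Cod C f = Cod C p\<rbrakk>
          \<Longrightarrow> \<exists>p' f'. is_pullback C p f p' f' \<and> admissible_epi E p'"
    and mono_cobase_change: "\<lbrakk>admissible_mono E i; f \<in> Arr C; Dom C f = Dom C i\<rbrakk>
          \<Longrightarrow> \<exists>i' f'. is_pushout C i f i' f' \<and> admissible_mono E i'"
    and obscure_epi: "\<lbrakk>f \<in> Arr C; \<exists>k. is_kernel C k f; g \<in> Arr C; Cod C g = Dom C f;
          admissible_epi E (f \<cdot> g)\<rbrakk> \<Longrightarrow> admissible_epi E f"
    and obscure_mono: "\<lbrakk>f \<in> Arr C; \<exists>c. is_cokernel C c f; g \<in> Arr C; Dom C g = Cod C f;
          admissible_mono E (g \<cdot> f)\<rbrakk> \<Longrightarrow> admissible_mono E f"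


section \<open>Frobenius categories\<close>

definition projective :: "('o, 'm, 'z) addcat_scheme \<Rightarrow> ('m \<times> 'm) set \<Rightarrow> 'o \<Rightarrow> bool" where
  "projective C E x \<longleftrightarrow> x \<in> Ob C \<and>
     (\<forall>p. admissible_epi E p \<longrightarrow>
        (\<forall>f \<in> Hom C x (Cod C p). \<exists>g \<in> Hom C x (Dom C p). p \<cdot>\<^bsub>C\<^esub> g = f))"

definition injective :: "('o, 'm, 'z) addcat_scheme \<Rightarrow> ('m \<times> 'm) set \<Rightarrow> 'o \<Rightarrow> bool" where
  "injective C E x \<longleftrightarrow> x \<in> Ob C \<and>
     (\<forall>i. admissible_mono E i \<longrightarrow>
        (\<forall>f \<in> Hom C (Dom C i) x. \<exists>g \<in> Hom C (Cod C i) x. g \<cdot>\<^bsub>C\<^esub> i = f))"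

locale Frobenius_category = exact_category C E
  for C :: "('o, 'm, 'z) addcat_scheme" (structure) and E :: "('m \<times> 'm) set" +
  assumes enough_projectives:
      "x \<in> Ob C \<Longrightarrow> \<exists>p. admissible_epi E p \<and> Cod C p = x \<and> projective C E (Dom C p)"
    and enough_injectives:
      "x \<in> Ob C \<Longrightarrow> \<exists>i. admissible_mono E i \<and> Dom C i = x \<and> injective C E (Cod C i)"
    and projective_iff_injective: "projective C E x \<longleftrightarrow> injective C E x"

end

theory Submission
  imports Defs
begin

text \<open>
  The idea is that in a Frobenius category the projective-injective objects alone detect which
  cokernel sequences are exact. Let \<open>E\<close> and \<open>F\<close> be two Frobenius structures with the same
  projective-injective objects, and let \<open>X \<rightarrow> Y \<rightarrow> Z\<close> be exact for \<open>E\<close>, with first arrow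
  \<open>i\<close>. As \<open>F\<close> has enough injectives, there is an \<open>F\<close>-admissible mono \<open>j\<close> from \<open>X\<close> to an
  \<open>F\<close>-injective object \<open>I\<close>. This object is also \<open>E\<close>-injective, so \<open>j\<close> extends along \<open>i\<close>, that
  is, \<open>j\<close> factors as \<open>g \<cdot> i\<close>. Since \<open>i\<close> has a cokernel, Quillen's obscure axiom for \<open>F\<close> turns
  this factorization into the \<open>F\<close>-admissibility of \<open>i\<close>. The second arrow of the sequence is then
  determined by \<open>i\<close> up to isomorphism, as its cokernel, so that the given sequence belongs to \<open>F\<close>
  (lemma \<open>exact_subset_if_injectives_subset\<close>). By symmetry \<open>E\<close> and \<open>F\<close> coincide.
\<close>

lemma (in category) isomorphism_Ident:
  assumes "x \<in> Ob C"
  shows "isomorphism C (Ident C x)"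
proof -
  have id: "Ident C x \<in> Hom C x x"
    using assms by (rule Ident_closed)
  then have "Ident C x \<cdot> Ident C x = Ident C x"
    by (rule Comp_Ident_left)
  with id show ?thesis
    by (auto simp: isomorphism_def Hom_def)
qed

lemma (in preadditive_category) is_cokernel_comparison:
  assumes "is_cokernel C p i" "is_cokernel C q i"
  obtains u where "u \<in> Hom C (Cod C p) (Cod C q)" "u \<cdot> p = q"
  using assms unfolding is_cokernel_def by metis

lemma (in preadditive_category) is_cokernel_endo_eq_Ident:
  assumes "is_cokernel C p i" "u \<in> Hom C (Cod C p) (Cod C p)" "u \<cdot> p = p"
  shows "u = Ident C (Cod C p)"
proof -
  have p: "p \<in> Arr C" and ex1: "\<exists>!u. u \<in> Hom C (Cod C p) (Cod C p) \<and> u \<cdot> p = p"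
    using assms(1) unfolding is_cokernel_def by auto
  have "Ident C (Cod C p) \<in> Hom C (Cod C p) (Cod C p)"
    using p by (intro Ident_closed Cod_closed)
  moreover have "Ident C (Cod C p) \<cdot> p = p"
    using p by (intro Comp_Ident_left[of _ "Dom C p"]) (simp add: Hom_def)
  ultimately show ?thesis
    using ex1 assms(2,3) by blast
qed

lemma (in preadditive_category) is_cokernel_unique_up_to_iso:
  assumes p: "is_cokernel C p i" and q: "is_cokernel C q i"
  obtains u where "isomorphism C u" "u \<in> Hom C (Cod C p) (Cod C q)" "u \<cdot> p = q"
proof -
  obtain u where u: "u \<in> Hom C (Cod C p) (Cod C q)" "u \<cdot> p = q"
    using is_cokernel_comparison[OF p q] .
  obtain v where v: "v \<in> Hom C (Cod C q) (Cod C p)" "v \<cdot> q = p"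
    using is_cokernel_comparison[OF q p] .
  have pH: "p \<in> Hom C (Cod C i) (Cod C p)" and qH: "q \<in> Hom C (Cod C i) (Cod C q)"
    using p q by (auto simp: is_cokernel_def Hom_def)
  have "v \<cdot> u = Ident C (Cod C p)"
    using p Comp_closed[OF u(1) v(1)]
    by (rule is_cokernel_endo_eq_Ident) (simp add: Comp_assoc[OF pH u(1) v(1)] u v)
  moreover have "u \<cdot> v = Ident C (Cod C q)"
    using q Comp_closed[OF v(1) u(1)]
    by (rule is_cokernel_endo_eq_Ident) (simp add: Comp_assoc[OF qH v(1) u(1)] u v)
  ultimately have "isomorphism C u"
    using u v by (auto simp: isomorphism_def Hom_def)
  then show thesis
    using u that by blast
qed

text \<open>Closure under isomorphism makes an admissible mono exact together with each of its
  cokernels, so membership in an exact structure is a property of the first arrow.\<close>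

lemma (in exact_category) exact_if_admissible_mono:
  assumes mono: "admissible_mono E i" and coker: "is_cokernel C p i"
  shows "(i, p) \<in> E"
proof -
  obtain q where iq: "(i, q) \<in> E"
    using mono unfolding admissible_mono_def by blast
  then have q: "is_cokernel C q i"
    using kernel_cokernel by blast
  obtain u where u: "isomorphism C u" "u \<in> Hom C (Cod C q) (Cod C p)" "u \<cdot> q = p"
    using is_cokernel_unique_up_to_iso[OF q coker] .
  have i: "i \<in> Hom C (Dom C i) (Cod C i)" and p: "p \<in> Hom C (Cod C i) (Cod C p)"
    using coker by (auto simp: is_cokernel_def Hom_def)
  have ob: "Dom C i \<in> Ob C" "Cod C i \<in> Ob C"
    using i Dom_closed Cod_closed by (auto simp: Hom_def)
  have "Ident C (Cod C i) \<cdot> i = i \<cdot> Ident C (Dom C i)"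
    using Comp_Ident_left[OF i] Comp_Ident_right[OF i] by simp
  moreover have "u \<cdot> q = p \<cdot> Ident C (Cod C i)"
    using u(3) Comp_Ident_right[OF p] by simp
  ultimately have "seq_iso C (i, q) (i, p)"
    using ob u(1,2) isomorphism_Ident Ident_closed unfolding seq_iso_def by blast
  then show ?thesis
    using iso_closed[OF iq] i p by (auto simp: Hom_def)
qed

text \<open>The two structures enter asymmetrically: \<open>F\<close> supplies an embedding into an injective
  object, and injectivity of that object for \<open>E\<close> supplies the factorization to which the obscure
  axiom of \<open>F\<close> applies.\<close>

lemma exact_subset_if_injectives_subset:
  assumes E: "exact_category C E" and F: "exact_category C F"
    and enough: "\<And>x. x \<in> Ob C \<Longrightarrow>
          \<exists>j. admissible_mono F j \<and> Dom C j = x \<and> injective C F (Cod C j)"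
    and inj: "\<And>x. injective C F x \<Longrightarrow> injective C E x"
  shows "E \<subseteq> F"
proof (rule subrelI)
  interpret E: exact_category C E by (rule E)
  interpret F: exact_category C F by (rule F)
  fix i p
  assume ip: "(i, p) \<in> E"
  then have coker: "is_cokernel C p i" and i: "i \<in> Arr C"
    using E.kernel_cokernel by (auto simp: is_cokernel_def)
  obtain j where j: "admissible_mono F j" "Dom C j = Dom C i" "injective C F (Cod C j)"
    using enough[OF E.Dom_closed[OF i]] by blast
  have "j \<in> Hom C (Dom C i) (Cod C j)"
    using j(1,2) F.kernel_cokernel
    unfolding admissible_mono_def is_kernel_def Hom_def by blast
  moreover have "admissible_mono E i"
    using ip unfolding admissible_mono_def by blast
  ultimately obtain g where g: "g \<in> Hom C (Cod C i) (Cod C j)" "g \<cdot>\<^bsub>C\<^esub> i = j"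
    using inj[OF j(3)] unfolding injective_def by blast
  have "admissible_mono F i"
    using F.obscure_mono[OF i, of g] coker g j(1) by (auto simp: Hom_def)
  then show "(i, p) \<in> F"
    using coker by (rule F.exact_if_admissible_mono)
qed

theorem corollary1p1p3:
  fixes B B0 :: "('o, 'm, 'z) addcat_scheme"
  assumes "additive_category B"
    and "full_subcategory B0 B"
  shows "\<exists>\<^sub>\<le>\<^sub>1 E. Frobenius_category B E \<and>
           B0 = full_subcategory_on B {x. projective B E x \<and> injective B E x}"
proof -
  have injective_iff: "injective B E x \<longleftrightarrow> x \<in> Ob B0"
    if "Frobenius_category B E"
      and B0: "B0 = full_subcategory_on B {x. projective B E x \<and> injective B E x}" for E x
  proof -
    have "x \<in> Ob B0 \<longleftrightarrow> projective B E x \<and> injective B E x"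
      by (subst B0) (simp add: full_subcategory_on_def)
    then show ?thesis
      using Frobenius_category.projective_iff_injective[OF that(1)] by blast
  qed
  have subset: "E \<subseteq> F"
    if E: "Frobenius_category B E"
        "B0 = full_subcategory_on B {x. projective B E x \<and> injective B E x}"
      and F: "Frobenius_category B F"
        "B0 = full_subcategory_on B {x. projective B F x \<and> injective B F x}" for E F
  proof (rule exact_subset_if_injectives_subset)
    show "exact_category B E" "exact_category B F"
      using E(1) F(1) by (simp_all add: Frobenius_category_def)
    show "\<exists>j. admissible_mono F j \<and> Dom B j = x \<and> injective B F (Cod B j)"
      if "x \<in> Ob B" for x
      using Frobenius_category.enough_injectives[OF F(1) that] .
    show "injective B E x" if "injective B F x" for x
      using that injective_iff[OF E] injective_iff[OF F] by blast
  qed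
  show ?thesis
    by (intro Uniq_I equalityI; elim conjE; rule subset; assumption)
qed

end
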